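(* The equation $x^3=4(x^2+x+1)$ has a unique real solution $R\approx 4.967$, and the competitive ratio of any deterministic preemptive online algorithm for the maximum weight matching problem is at least $R$. That is, for every deterministic preemptive online algorithm and every real $c<R$, there is an input sequence of weighted edges on which the weight of a maximum weight matching of the input graph exceeds $c$ times the weight of the matching held by the algorithm at the end.
   Context: Maximum weight matching: given a finite undirected graph $G=(V,E)$ with non-negative edge weights $w:E\to\mathbb{R}_+$, a matching is a set of edges no two of which share a vertex, its weight is the sum of the weights of its edges, and the goal is to maximize this weight. Preemptive online model: the graph (including its size) is not known in advance. Edges are presented one by one together with their weights. The algorithm maintains a current set of edges which must be a matching at all times. When an edge is presented, the algorithm must decide immediately whether to accept it into the current matching or reject it; at any point in time it may remove (preempt) previously accepted edges from the current matching. An edge that was rejected or preempted can never be inserted into the matching later. There is no restriction on the computation time or on the additional memory used by the algorithm to record information about the past. The output is the matching held at the end of the input. The competitive ratio of an algorithm is the infimum of all $c$ such that for every input sequence the maximum weight of a matching in the input graph is at most $c$ times the weight of the algorithm's output (it is $+\infty$ if no such $c$ exists). *)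

theory Defs
  imports Complex_Main "HOL-Library.Extended_Real"
begin

text \<open>
  An input sequence lists the edges of a finite simple graph with their weights, in order of
  arrival. Vertices are named by natural numbers, so that arbitrarily many of them are available;
  an edge is the set of its two endpoints.
\<close>

type_synonym edge = "nat set"
type_synonym input = "(edge \<times> real) list"

definition valid_input :: "input \<Rightarrow> bool" where
  "valid_input \<sigma> \<longleftrightarrow>
     distinct (map fst \<sigma>) \<and> (\<forall>(e, w) \<in> set \<sigma>. card e = 2 \<and> w \<ge> 0)"

definition edges :: "input \<Rightarrow> edge set" where
  "edges \<sigma> = fst ` set \<sigma>"

definition matching :: "edge set \<Rightarrow> bool" where
  "matching M \<longleftrightarrow> (\<forall>e\<in>M. \<forall>f\<in>M. e \<noteq> f \<longrightarrow> e \<inter> f = {})"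

definition weight :: "input \<Rightarrow> edge set \<Rightarrow> real" where
  "weight \<sigma> M = (\<Sum>e\<in>M. the (map_of \<sigma> e))"

definition opt :: "input \<Rightarrow> real" where
  "opt \<sigma> = Max {weight \<sigma> M |M. M \<subseteq> edges \<sigma> \<and> matching M}"

text \<open>
  With unrestricted memory and computation, a deterministic online algorithm is a function from
  the input seen so far to the matching currently held. When \<open>e\<close> arrives, the new
  matching consists of edges held before and possibly \<open>e\<close>. As no edge is presented twice, a
  rejected or preempted edge never comes back. Behaviour on invalid inputs is unconstrained.
\<close>

definition preemptive_online_algorithm :: "(input \<Rightarrow> edge set) \<Rightarrow> bool" where
  "preemptive_online_algorithm A \<longleftrightarrow>
     A [] = {} \<and>
     (\<forall>\<sigma> e w. valid_input (\<sigma> @ [(e, w)]) \<longrightarrow> A (\<sigma> @ [(e, w)]) \<subseteq> insert e (A \<sigma>)) \<and>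
     (\<forall>\<sigma>. valid_input \<sigma> \<longrightarrow> matching (A \<sigma>))"

text \<open>In \<open>ereal\<close> the infimum of the empty set is \<open>\<infinity>\<close>.\<close>

definition competitive_ratio :: "(input \<Rightarrow> edge set) \<Rightarrow> ereal" where
  "competitive_ratio A =
     Inf {ereal c |c. \<forall>\<sigma>. valid_input \<sigma> \<longrightarrow> opt \<sigma> \<le> c * weight \<sigma> (A \<sigma>)}"

end

theory Submission
  imports Defs
begin

text \<open>
  Suppose some algorithm is \<open>5\<close>-competitive; as \<open>R < 5\<close>, it suffices to refute this. The adversary
  maintains that the algorithm holds a single edge \<open>{a, b}\<close>, of weight \<open>y\<close>, while some matching
  avoiding \<open>a\<close> and \<open>b\<close> has weight at least \<open>H\<close>. It offers edges from \<open>a\<close> and from \<open>b\<close> alternately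
  to fresh vertices, with weights growing in steps of \<open>y / 50\<close>. As long as both edges of weight
  \<open>u\<close> are rejected there is a matching of weight \<open>H + 2 u\<close>, so some edge of weight \<open>v\<close> about
  \<open>(5 y - H) / 2\<close> or less must be accepted, preempting \<open>{a, b}\<close>. The last rejected edge at the other
  endpoint then joins the matching that the algorithm misses, and \<open>(y, H)\<close> becomes
  \<open>(v, H + v - y / 50)\<close>. This raises \<open>H / y\<close> by at least \<open>1 / 10\<close>, whereas \<open>H \<le> 5 y\<close> always.
  With a finer step the argument refutes every ratio below \<open>3 + 2 * sqrt 2\<close>, as
  \<open>h \<mapsto> 1 + 2 * h / (c - h)\<close> has no fixed point for such \<open>c\<close>.
\<close>

section \<open>The cubic equation and its root\<close>

text \<open>In the difference of the two values, \<open>y - x\<close> factors out; the cofactor is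
  \<open>x * (x - 4) + y * (y - 4) + (x * y - 4)\<close>, which is positive.\<close>

lemma cubic_less:
  fixes x y :: real
  assumes "4 < x" "x < y"
  shows "x ^ 3 - 4 * (x ^ 2 + x + 1) < y ^ 3 - 4 * (y ^ 2 + y + 1)"
proof -
  have "0 < x * (x - 4)" "0 < y * (y - 4)" "16 < x * y"
    using assms mult_strict_mono[of 4 x 4 y] by simp_all
  then have "0 < x * x + x * y + y * y - 4 * (x + y) - 4"
    by (simp add: algebra_simps)
  then have "0 < (y - x) * (x * x + x * y + y * y - 4 * (x + y) - 4)"
    using assms by simp
  then show ?thesis
    by (simp add: algebra_simps power2_eq_square power3_eq_cube)
qed

lemma cubic_root_gt_4:
  fixes x :: real
  assumes "x ^ 3 = 4 * (x ^ 2 + x + 1)"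
  shows "4 < x"
proof (rule ccontr)
  assume "\<not> 4 < x"
  have eq: "x ^ 2 * (4 - x) = - 4 * (x + 1)"
    using assms by (simp add: algebra_simps power2_eq_square power3_eq_cube)
  have "0 \<le> x ^ 2 * (4 - x)"
    using \<open>\<not> 4 < x\<close> by simp
  with eq have "x \<le> -1"
    by simp
  then have "1 * - x \<le> - x * - x" "x ^ 2 * 5 \<le> x ^ 2 * (4 - x)"
    by (intro mult_right_mono mult_left_mono; simp)+
  with eq \<open>x \<le> -1\<close> show False
    by (simp add: power2_eq_square)
qed

lemma cubic_root_bounds:
  fixes x :: real
  assumes "x ^ 3 = 4 * (x ^ 2 + x + 1)"
  shows "4.9665 < x" "x < 4.9675"
proof -
  have "4 < x" by (rule cubic_root_gt_4[OF assms])
  show "4.9665 < x"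
    using cubic_less[OF \<open>4 < x\<close>, of "4.9665"] assms
    by (cases x "4.9665 :: real" rule: linorder_cases) (simp_all add: power2_eq_square power3_eq_cube)
  show "x < 4.9675"
    using cubic_less[of "4.9675" x] assms
    by (cases x "4.9675 :: real" rule: linorder_cases) (simp_all add: power2_eq_square power3_eq_cube)
qed

text \<open>The sign changes on the interval from 4 to 5. All real roots lie beyond 4, where the
  cubic is strictly increasing.\<close>

lemma cubic_ex1_root: "\<exists>!x::real. x ^ 3 = 4 * (x ^ 2 + x + 1)"
proof -
  have "\<exists>x\<ge>4. x \<le> 5 \<and> x ^ 3 - 4 * (x ^ 2 + x + 1) = (0::real)"
    by (intro IVT') (auto intro!: continuous_intros)
  then show ?thesis
    using cubic_less cubic_root_gt_4 by (metis eq_iff_diff_eq_0 less_irrefl linorder_neqE_linordered_idom)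
qed

section \<open>Inputs, weights and matchings\<close>

lemma finite_edges: "finite (edges \<sigma>)"
  by (simp add: edges_def)

lemma edges_snoc: "edges (\<sigma> @ [(e, w)]) = insert e (edges \<sigma>)"
  by (simp add: edges_def)

lemma valid_input_snoc:
  "valid_input (\<sigma> @ [(e, w)]) \<longleftrightarrow> valid_input \<sigma> \<and> e \<notin> edges \<sigma> \<and> card e = 2 \<and> 0 \<le> w"
  by (auto simp: valid_input_def edges_def)

lemma weight_le_opt:
  assumes "M \<subseteq> edges \<sigma>" "matching M"
  shows "weight \<sigma> M \<le> opt \<sigma>"
proof -
  have "{weight \<sigma> M |M. M \<subseteq> edges \<sigma> \<and> matching M} \<subseteq> weight \<sigma> ` Pow (edges \<sigma>)"
    by auto
  then show ?thesis
    unfolding opt_def using assms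
    by (intro Max_ge) (auto intro: finite_subset simp: finite_edges)
qed

lemma weight_snoc:
  assumes "M \<subseteq> edges \<sigma>"
  shows "weight (\<sigma> @ [(e, w)]) M = weight \<sigma> M"
  unfolding weight_def
proof (rule sum.cong)
  fix f assume "f \<in> M"
  with assms have "map_of \<sigma> f \<noteq> None"
    by (auto simp: edges_def map_of_eq_None_iff)
  then show "the (map_of (\<sigma> @ [(e, w)]) f) = the (map_of \<sigma> f)"
    by (auto simp: map_add_def split: option.splits)
qed simp

lemma weight_snoc_new:
  assumes "e \<notin> edges \<sigma>"
  shows "weight (\<sigma> @ [(e, w)]) {e} = w"
  using assms by (simp add: weight_def edges_def map_add_def map_of_eq_None_iff[THEN iffD2])

lemma weight_insert:
  assumes "M \<subseteq> edges \<sigma>" "e \<notin> M"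
  shows "weight \<sigma> (insert e M) = weight \<sigma> {e} + weight \<sigma> M"
  using assms finite_subset[OF assms(1) finite_edges] by (simp add: weight_def)

lemma weight_nonneg:
  assumes "valid_input \<sigma>" "M \<subseteq> edges \<sigma>"
  shows "0 \<le> weight \<sigma> M"
  unfolding weight_def
proof (rule sum_nonneg)
  fix e assume "e \<in> M"
  with assms obtain w where "map_of \<sigma> e = Some w"
    by (metis edges_def map_of_eq_None_iff not_None_eq subsetD)
  moreover from this have "(e, w) \<in> set \<sigma>"
    by (rule map_of_SomeD)
  ultimately show "0 \<le> the (map_of \<sigma> e)"
    using assms(1) by (auto simp: valid_input_def)
qed

lemma matching_insert:
  assumes "matching M" "\<Union>M \<inter> e = {}"
  shows "matching (insert e M)"
  using assms unfolding matching_def by blast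

lemma algorithm_subset_edges:
  assumes "preemptive_online_algorithm A" "valid_input \<sigma>"
  shows "A \<sigma> \<subseteq> edges \<sigma>"
  using assms(2)
proof (induction \<sigma> rule: rev_induct)
  case Nil
  then show ?case
    using assms(1) by (simp add: preemptive_online_algorithm_def)
next
  case (snoc x \<sigma>)
  obtain e w where [simp]: "x = (e, w)" by (cases x)
  have "A (\<sigma> @ [x]) \<subseteq> insert e (A \<sigma>)" "valid_input \<sigma>"
    using assms(1) snoc.prems by (auto simp: preemptive_online_algorithm_def valid_input_snoc)
  then show ?case
    using snoc.IH by (auto simp: edges_snoc)
qed

section \<open>Matchings that leave given vertices free\<close>

text \<open>\<open>X\<close> holds the vertices kept free for edges still to be added. Asking only
  for a lower bound \<open>s\<close> allows the value to be lowered at will.\<close>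

definition matching_avoiding :: "input \<Rightarrow> nat set \<Rightarrow> real \<Rightarrow> bool" where
  "matching_avoiding \<sigma> X s \<longleftrightarrow>
     (\<exists>M \<subseteq> edges \<sigma>. matching M \<and> \<Union>M \<inter> X = {} \<and> s \<le> weight \<sigma> M)"

lemma matching_avoidingI:
  "M \<subseteq> edges \<sigma> \<Longrightarrow> matching M \<Longrightarrow> \<Union>M \<inter> X = {} \<Longrightarrow> s \<le> weight \<sigma> M \<Longrightarrow>
    matching_avoiding \<sigma> X s"
  unfolding matching_avoiding_def by blast

lemma matching_avoidingE:
  assumes "matching_avoiding \<sigma> X s"
  obtains M where "M \<subseteq> edges \<sigma>" "matching M" "\<Union>M \<inter> X = {}" "s \<le> weight \<sigma> M"
  using assms unfolding matching_avoiding_def by blast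

lemma matching_avoiding_le_opt: "matching_avoiding \<sigma> X s \<Longrightarrow> s \<le> opt \<sigma>"
  by (meson matching_avoidingE order_trans weight_le_opt)

lemma matching_avoiding_mono:
  "matching_avoiding \<sigma> X s \<Longrightarrow> Y \<subseteq> X \<Longrightarrow> t \<le> s \<Longrightarrow> matching_avoiding \<sigma> Y t"
  by (erule matching_avoidingE) (rule matching_avoidingI, assumption+, auto)

lemma matching_avoiding_snoc:
  assumes "matching_avoiding \<sigma> X s"
  shows "matching_avoiding (\<sigma> @ [(e, w)]) X s"
proof -
  obtain M where "M \<subseteq> edges \<sigma>" "matching M" "\<Union>M \<inter> X = {}" "s \<le> weight \<sigma> M"
    using assms by (rule matching_avoidingE)
  then show ?thesis
    by (intro matching_avoidingI[of M]) (simp_all add: edges_snoc weight_snoc subset_insertI2)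
qed

lemma matching_avoiding_fresh:
  "matching_avoiding \<sigma> X s \<Longrightarrow> c \<notin> \<Union>(edges \<sigma>) \<Longrightarrow> matching_avoiding \<sigma> (insert c X) s"
  by (erule matching_avoidingE) (rule matching_avoidingI, assumption+, auto)

lemma matching_avoiding_add_edge:
  assumes "matching_avoiding \<sigma> (e \<union> X) s" "e \<in> edges \<sigma>" "e \<noteq> {}" "e \<inter> X = {}"
  shows "matching_avoiding \<sigma> X (s + weight \<sigma> {e})"
proof -
  obtain M where M: "M \<subseteq> edges \<sigma>" "matching M" "\<Union>M \<inter> (e \<union> X) = {}" "s \<le> weight \<sigma> M"
    using assms(1) by (rule matching_avoidingE)
  from M(3) \<open>e \<noteq> {}\<close> have "e \<notin> M"
    by blast
  with M have "weight \<sigma> (insert e M) \<ge> s + weight \<sigma> {e}"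
    using weight_insert[of M \<sigma> e] by linarith
  moreover have "matching (insert e M)"
    using M by (intro matching_insert) auto
  ultimately show ?thesis
    using M assms(2,4) by (intro matching_avoidingI[of "insert e M"]) auto
qed

section \<open>The adversary against a 5-competitive algorithm\<close>

locale five_competitive =
  fixes A :: "input \<Rightarrow> edge set"
  assumes online: "preemptive_online_algorithm A"
    and competitive: "valid_input \<sigma> \<Longrightarrow> opt \<sigma> \<le> 5 * weight \<sigma> (A \<sigma>)"
begin

text \<open>\<open>p\<close> and \<open>q\<close> are the weights of the last rejected edges at \<open>a\<close> and \<open>b\<close>, with \<open>0\<close> for none.\<close>

definition holding :: "input \<Rightarrow> nat \<Rightarrow> nat \<Rightarrow> real \<Rightarrow> real \<Rightarrow> real \<Rightarrow> real \<Rightarrow> bool" where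
  "holding \<sigma> a b y H p q \<longleftrightarrow>
     valid_input \<sigma> \<and> a \<noteq> b \<and> A \<sigma> = {{a, b}} \<and> weight \<sigma> {{a, b}} = y \<and> 0 < y \<and>
     matching_avoiding \<sigma> {a, b} H \<and> matching_avoiding \<sigma> {b} (H + p) \<and>
     matching_avoiding \<sigma> {a} (H + q) \<and> matching_avoiding \<sigma> {} (H + p + q)"

lemma holding_commute: "holding \<sigma> a b y H p q \<Longrightarrow> holding \<sigma> b a y H q p"
  by (simp add: holding_def insert_commute add.commute add.left_commute)

lemma holding_mono:
  "holding \<sigma> a b y H p q \<Longrightarrow> H' \<le> H \<Longrightarrow> holding \<sigma> a b y H' p q"
  unfolding holding_def
  by (elim conjE, intro conjI)
    (assumption | erule matching_avoiding_mono, rule subset_refl, linarith)+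

text \<open>The algorithm holds weight \<open>y\<close>, so no matching exceeds
  \<open>5 * y\<close>. One competitor uses both rejected edges, the other adds
  \<open>{a, b}\<close> itself to the matching avoiding \<open>a\<close> and
  \<open>b\<close>.\<close>

lemma holding_bounds:
  assumes "holding \<sigma> a b y H p q"
  shows "H + p + q \<le> 5 * y" "H + y \<le> 5 * y" "matching_avoiding \<sigma> {} (H + y)"
proof -
  have "{a, b} \<in> edges \<sigma>"
    using assms algorithm_subset_edges[OF online] unfolding holding_def by blast
  then show *: "matching_avoiding \<sigma> {} (H + y)"
    using assms matching_avoiding_add_edge[of \<sigma> "{a, b}" "{}" H] by (auto simp: holding_def)
  show "H + p + q \<le> 5 * y" "H + y \<le> 5 * y"
    using assms competitive[of \<sigma>] matching_avoiding_le_opt[OF *]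
      matching_avoiding_le_opt[of \<sigma> "{}" "H + p + q"]
    by (auto simp: holding_def)
qed

text \<open>A single edge of weight 1 has to be accepted, since holding nothing would have unbounded
  ratio; the empty matching gives \<open>H = 0\<close>.\<close>

lemma start: "\<exists>\<sigma> a b y. holding \<sigma> a b y 0 0 0"
proof -
  let ?\<sigma> = "[] @ [({0, 1}, 1)] :: input"
  have valid: "valid_input ?\<sigma>"
    by (simp add: valid_input_def)
  then have sub: "A ?\<sigma> \<subseteq> {{0, 1}}"
    using algorithm_subset_edges[OF online] by (fastforce simp: edges_def)
  have w: "weight ?\<sigma> {{0, 1}} = 1"
    by (simp add: weight_def)
  have avoid: "matching_avoiding ?\<sigma> X 0" for X
    unfolding matching_avoiding_def
    by (intro exI[of _ "{}"]) (simp add: matching_def weight_def)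
  have "1 \<le> opt ?\<sigma>"
    using weight_le_opt[of "{{0, 1}}" ?\<sigma>] w by (simp add: edges_def matching_def)
  then have "weight ?\<sigma> (A ?\<sigma>) \<noteq> 0"
    using competitive[OF valid] by linarith
  then have "A ?\<sigma> \<noteq> {}"
    by (metis sum.empty weight_def)
  then have "A ?\<sigma> = {{0, 1}}"
    using sub by blast
  then have "holding ?\<sigma> 0 1 1 0 0 0"
    using valid w avoid unfolding holding_def by simp
  then show ?thesis by blast
qed

text \<open>The offered edge joins \<open>a\<close> to a fresh vertex. On rejection it takes the
  place of the previous rejected edge at \<open>a\<close>. On acceptance the matching of weight
  \<open>H + q\<close>, which uses the rejected edge at \<open>b\<close>, avoids both endpoints of
  the new edge.\<close>

lemma offer:
  assumes "holding \<sigma> a b y H p q" "0 \<le> v"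
  shows "(\<exists>\<sigma>'. holding \<sigma>' a b y H v q) \<or>
    (\<exists>\<sigma>' c. holding \<sigma>' a c v (H + q) 0 0 \<and> H + y \<le> 5 * v)"
proof -
  have hold: "valid_input \<sigma>" "a \<noteq> b" "A \<sigma> = {{a, b}}" "weight \<sigma> {{a, b}} = y" "0 < y"
    "matching_avoiding \<sigma> {a, b} H" "matching_avoiding \<sigma> {b} (H + p)"
    "matching_avoiding \<sigma> {a} (H + q)" "matching_avoiding \<sigma> {} (H + p + q)"
    using assms(1) by (auto simp: holding_def)
  have ab: "{a, b} \<in> edges \<sigma>"
    using hold algorithm_subset_edges[OF online] by blast
  have "finite (\<Union>(edges \<sigma>))"
    using \<open>valid_input \<sigma>\<close>
    by (auto simp: finite_edges edges_def valid_input_def intro!: card_ge_0_finite)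
  then obtain c where c: "c \<notin> \<Union>(edges \<sigma>)"
    by (meson ex_new_if_finite infinite_UNIV_nat)
  then have ne: "c \<noteq> a" "c \<noteq> b"
    using ab by auto
  define e where "e = {a, c}"
  define \<sigma>' where "\<sigma>' = \<sigma> @ [(e, v)]"
  have new: "e \<notin> edges \<sigma>"
    using c by (auto simp: e_def)
  have valid: "valid_input \<sigma>'"
    using hold new ne assms(2) by (auto simp: \<sigma>'_def valid_input_snoc e_def)
  have wab: "weight \<sigma>' {{a, b}} = y"
    using ab hold by (simp add: \<sigma>'_def weight_snoc)
  have we: "weight \<sigma>' {e} = v"
    using new by (simp add: \<sigma>'_def weight_snoc_new)
  have e_in: "e \<in> edges \<sigma>'"
    by (simp add: \<sigma>'_def edges_snoc)
  have avoid: "matching_avoiding \<sigma>' X s" if "matching_avoiding \<sigma> X s" for X s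
    using that by (simp add: \<sigma>'_def matching_avoiding_snoc)
  have avoid_c: "matching_avoiding \<sigma>' (insert c X) s" if "matching_avoiding \<sigma> X s" for X s
    using that c by (intro avoid matching_avoiding_fresh)
  have "matching_avoiding \<sigma>' {} (H + y)"
    using holding_bounds[OF assms(1)] avoid by blast
  then have Hy_le: "H + y \<le> 5 * weight \<sigma>' (A \<sigma>')"
    using competitive[OF valid] matching_avoiding_le_opt order_trans by blast
  have "y \<le> opt \<sigma>'"
    using weight_le_opt[of "{{a, b}}" \<sigma>'] ab wab
    by (simp add: \<sigma>'_def edges_snoc matching_def)
  then have y_le: "y \<le> 5 * weight \<sigma>' (A \<sigma>')"
    using competitive[OF valid] by simp
  have "A \<sigma>' \<subseteq> {e, {a, b}}"
    using online valid hold unfolding preemptive_online_algorithm_def \<sigma>'_def by metis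
  \<comment> \<open>Both edges contain \<open>a\<close>, so at most one is held; the positive
    optimum excludes the empty matching.\<close>
  moreover have "\<not> {e, {a, b}} \<subseteq> A \<sigma>'"
    using online valid ne unfolding preemptive_online_algorithm_def matching_def e_def
    by (metis doubleton_eq_iff insert_disjoint(1) insert_subset singletonI insertI1)
  moreover have "A \<sigma>' \<noteq> {}"
  proof
    assume "A \<sigma>' = {}"
    with y_le show False
      using \<open>0 < y\<close> by (simp add: weight_def)
  qed
  ultimately consider "A \<sigma>' = {e}" | "A \<sigma>' = {{a, b}}"
    by blast
  then show ?thesis
  proof cases
    case 1
    then have "H + y \<le> 5 * v"
      using Hy_le we by simp
    have "0 < v"
      using y_le 1 we \<open>0 < y\<close> by simp
    have "matching_avoiding \<sigma>' {a, c} (H + q)"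
      using avoid_c[OF hold(8)] by (simp add: insert_commute)
    then have "holding \<sigma>' a c v (H + q) 0 0"
      using valid ne 1 we \<open>0 < v\<close> unfolding holding_def e_def
      by (auto elim!: matching_avoiding_mono)
    with \<open>H + y \<le> 5 * v\<close> show ?thesis by blast
  next
    case 2
    have "matching_avoiding \<sigma>' {b} (H + v)"
      using matching_avoiding_add_edge[of \<sigma>' e "{b}" H] avoid_c[OF hold(6)] e_in we hold ne
      by (simp add: e_def insert_commute)
    moreover have "matching_avoiding \<sigma>' {} (H + v + q)"
      using matching_avoiding_add_edge[of \<sigma>' e "{}" "H + q"] avoid_c[OF hold(8)] e_in we
      by (simp add: e_def insert_commute add.commute add.left_commute)
    ultimately have "holding \<sigma>' a b y H v q"
      using valid hold 2 wab avoid unfolding holding_def by simp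
    then show ?thesis by blast
  qed
qed

text \<open>By symmetry \<open>offer\<close> applies at \<open>b\<close> after a rejection at
  \<open>a\<close>. If the first edge is accepted, the rejected edge at \<open>b\<close> contributes
  \<open>u\<close>; if the second is, the one at \<open>a\<close> contributes \<open>u + d\<close>,
  lowered to \<open>u\<close> for a uniform conclusion.\<close>

lemma offer_both:
  assumes "holding \<sigma> a b y H u u" "0 \<le> u" "0 \<le> d"
  shows "(\<exists>\<sigma>'. holding \<sigma>' a b y H (u + d) (u + d)) \<or>
    (\<exists>\<sigma>' a' b'. holding \<sigma>' a' b' (u + d) (H + u) 0 0 \<and> H + y \<le> 5 * (u + d))"
proof -
  have "0 \<le> u + d"
    using assms by simp
  from offer[OF assms(1) this] show ?thesis
  proof
    assume "\<exists>\<sigma>'. holding \<sigma>' a b y H (u + d) u"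
    then obtain \<sigma>' where "holding \<sigma>' b a y H u (u + d)"
      using holding_commute by blast
    from offer[OF this \<open>0 \<le> u + d\<close>] show ?thesis
    proof
      assume "\<exists>\<sigma>''. holding \<sigma>'' b a y H (u + d) (u + d)"
      then show ?thesis
        using holding_commute by blast
    next
      assume "\<exists>\<sigma>'' c. holding \<sigma>'' b c (u + d) (H + (u + d)) 0 0 \<and> H + y \<le> 5 * (u + d)"
      moreover have "H + u \<le> H + (u + d)"
        using \<open>0 \<le> d\<close> by simp
      ultimately show ?thesis
        using holding_mono by blast
    qed
  qed blast
qed

text \<open>Endless rejection would give matchings of weight \<open>H + 2 * k * d\<close> for all
  \<open>k\<close>, against the bound \<open>5 * y\<close>. Here \<open>u\<close> is the last weight
  rejected at both endpoints, or 0.\<close>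

lemma phase:
  assumes "holding \<sigma> a b y H 0 0" "0 < d"
  shows "\<exists>\<sigma>' a' b' u. holding \<sigma>' a' b' (u + d) (H + u) 0 0 \<and>
    H + y \<le> 5 * (u + d) \<and> H + 2 * u \<le> 5 * y"
proof (rule ccontr)
  assume never: "\<not> ?thesis"
  have rejected: "\<exists>\<sigma>'. holding \<sigma>' a b y H (real k * d) (real k * d)" for k
  proof (induction k)
    case 0
    then show ?case
      using assms(1) by auto
  next
    case (Suc k)
    then obtain \<sigma>' where *: "holding \<sigma>' a b y H (real k * d) (real k * d)" by blast
    then have "H + 2 * (real k * d) \<le> 5 * y"
      using holding_bounds(1)[OF *] by linarith
    with never offer_both[OF *, of d] \<open>0 < d\<close>
    have "\<exists>\<sigma>'. holding \<sigma>' a b y H (real k * d + d) (real k * d + d)"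
      by (meson less_imp_le mult_nonneg_nonneg of_nat_0_le_iff)
    then show ?case
      by (simp add: algebra_simps)
  qed
  obtain k where "5 * y - H < real k * (2 * d)"
    using reals_Archimedean3[of "2 * d"] \<open>0 < d\<close> by auto
  moreover from rejected[of k] have "H + real k * d + real k * d \<le> 5 * y"
    using holding_bounds(1) by blast
  ultimately show False
    by (simp add: algebra_simps)
qed

section \<open>Growth of the ratio \<open>H / y\<close>\<close>

lemma phase_gain:
  assumes "holding \<sigma> a b y H 0 0" "h * y \<le> H" "0 \<le> h"
  shows "\<exists>\<sigma>' a' b' y' H'. holding \<sigma>' a' b' y' H' 0 0 \<and> (h + 1 / 10) * y' \<le> H'"
proof -
  have "0 < y"
    using assms(1) by (simp add: holding_def)
  \<comment> \<open>With \<open>H\<close> lowered to exactly \<open>h * y\<close>, all inequalities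
    scale with \<open>y\<close> and only \<open>h\<close> and \<open>t = u / y\<close>
    matter.\<close>
  have hold: "holding \<sigma> a b y (h * y) 0 0"
    using holding_mono assms by blast
  obtain \<sigma>' a' b' u where
    *: "holding \<sigma>' a' b' (u + y / 50) (h * y + u) 0 0"
       "h * y + y \<le> 5 * (u + y / 50)" "h * y + 2 * u \<le> 5 * y"
    using phase[OF hold, of "y / 50"] \<open>0 < y\<close> by auto
  define t where "t = u / y"
  have u: "u = t * y"
    using \<open>0 < y\<close> by (simp add: t_def)
  have "(h + 1) * y \<le> (5 * t + 1 / 10) * y" "(h + 2 * t) * y \<le> 5 * y"
    using *(2,3) unfolding u by (simp_all add: algebra_simps)
  then have t: "h + 1 \<le> 5 * t + 1 / 10" "h + 2 * t \<le> 5"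
    using \<open>0 < y\<close> by (auto dest: mult_right_le_imp_le)
  \<comment> \<open>The right side minus the left is affine in \<open>t\<close> with slope
    \<open>9 / 10 - h\<close>. The sign of the slope decides whether the lower or the upper bound on
    \<open>t\<close> is the critical one.\<close>
  have "(h + 1 / 10) * (t + 1 / 50) \<le> h + t"
  proof (cases "h \<le> 9 / 10")
    case True
    then have "(9 / 10 - h) * (9 / 50) \<le> (9 / 10 - h) * t"
      using t \<open>0 \<le> h\<close> by (intro mult_left_mono) auto
    then show ?thesis
      using \<open>0 \<le> h\<close> unfolding distrib_left distrib_right left_diff_distrib by linarith
  next
    case False
    then have "0 \<le> (h - 9 / 10) * (5 - h - 2 * t)"
      using t by simp
    \<comment> \<open>At the upper bound \<open>t = (5 - h) / 2\<close> the first product vanishes;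
      completing the square shows that the rest is positive.\<close>
    moreover have "2 * (h + t - (h + 1 / 10) * (t + 1 / 50)) =
        (h - 9 / 10) * (5 - h - 2 * t) + (h - 2) ^ 2 + (3 * h / 50 + 62 / 125)"
      by (simp add: field_simps power2_eq_square)
    ultimately have "0 \<le> 2 * (h + t - (h + 1 / 10) * (t + 1 / 50))"
      using False by (metis add_nonneg_nonneg divide_nonneg_pos mult_nonneg_nonneg zero_le_numeral
          \<open>0 \<le> h\<close> zero_le_power2 zero_less_numeral)
    then show ?thesis
      by simp
  qed
  then have "(h + 1 / 10) * (t + 1 / 50) * y \<le> (h + t) * y"
    using \<open>0 < y\<close> by (intro mult_right_mono) auto
  then have "(h + 1 / 10) * (u + y / 50) \<le> h * y + u"
    unfolding u by (simp add: algebra_simps)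
  with *(1) show ?thesis by blast
qed

lemma contradiction: False
proof -
  have "\<exists>\<sigma> a b y H. holding \<sigma> a b y H 0 0 \<and> real k / 10 * y \<le> H" for k
  proof (induction k)
    case 0
    then show ?case
      using start by fastforce
  next
    case (Suc k)
    then show ?case
      using phase_gain[where h = "real k / 10"] by (fastforce simp: add_divide_distrib add.commute)
  qed
  \<comment> \<open>Fifty gains of \<open>1 / 10\<close> reach the ratio 5, while
    \<open>H + y \<le> 5 * y\<close> caps it at 4.\<close>
  from this[of 50] obtain \<sigma> a b y H where "holding \<sigma> a b y H 0 0" "5 * y \<le> H"
    by auto
  from this(1) have "H + y \<le> 5 * y" "0 < y"
    by (rule holding_bounds(2), simp add: holding_def)
  with \<open>5 * y \<le> H\<close> show False
    by linarith
qed

end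

section \<open>The lower bound on the competitive ratio\<close>

lemma opt_gt_5_weight:
  assumes "preemptive_online_algorithm A"
  shows "\<exists>\<sigma>. valid_input \<sigma> \<and> 5 * weight \<sigma> (A \<sigma>) < opt \<sigma>"
  using five_competitive.contradiction[OF five_competitive.intro[OF assms]] by force

theorem theorem3p1:
  "(\<exists>!x::real. x ^ 3 = 4 * (x ^ 2 + x + 1)) \<and>
   (\<forall>R::real. R ^ 3 = 4 * (R ^ 2 + R + 1) \<longrightarrow>
      \<bar>R - 4.967\<bar> < 0.0005 \<and>
      (\<forall>A. preemptive_online_algorithm A \<longrightarrow>
         competitive_ratio A \<ge> ereal R \<and>
         (\<forall>c<R. \<exists>\<sigma>. valid_input \<sigma> \<and> opt \<sigma> > c * weight \<sigma> (A \<sigma>))))"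
proof (intro conjI allI impI cubic_ex1_root)
  fix R :: real
  assume R: "R ^ 3 = 4 * (R ^ 2 + R + 1)"
  show "\<bar>R - 4.967\<bar> < 0.0005"
    using cubic_root_bounds[OF R] unfolding abs_less_iff by simp
  fix A assume A: "preemptive_online_algorithm A"
  show bad: "\<exists>\<sigma>. valid_input \<sigma> \<and> opt \<sigma> > c * weight \<sigma> (A \<sigma>)" if "c < R" for c
  proof -
    obtain \<sigma> where \<sigma>: "valid_input \<sigma>" "5 * weight \<sigma> (A \<sigma>) < opt \<sigma>"
      using opt_gt_5_weight[OF A] by blast
    \<comment> \<open>Since \<open>c < R < 5\<close> and the held weight is nonnegative, the input
      refuting 5 also refutes \<open>c\<close>, even a negative one.\<close>
    have "c * weight \<sigma> (A \<sigma>) \<le> 5 * weight \<sigma> (A \<sigma>)"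
      using that cubic_root_bounds[OF R] weight_nonneg algorithm_subset_edges[OF A] \<sigma>(1)
      by (intro mult_right_mono) auto
    with \<sigma> show ?thesis by fastforce
  qed
  show "competitive_ratio A \<ge> ereal R"
    unfolding competitive_ratio_def
  proof (rule Inf_greatest, clarify)
    fix c assume "\<forall>\<sigma>. valid_input \<sigma> \<longrightarrow> opt \<sigma> \<le> c * weight \<sigma> (A \<sigma>)"
    then show "ereal R \<le> ereal c"
      using bad[of c] by (force simp: not_less)
  qed
qed

end
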